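(* The following statements hold. (A) For any $n, r$ the inequalities $$n\ge \chi(G(n,r,r-1))\ge n-r+1$$ hold if $n-r$ is even, and $$n\ge \chi(G(n,r,r-1))\ge n-r+2$$ hold if $n-r$ is odd. (B) For $n=rk-1$ and $r$ prime, the bound $\chi(G(n,r,r-1))\ge n-r+2$ holds.
   Context: Let $\mathcal{R}_n=\{0,1,\ldots,n-1\}$ and let $G(n,r,s)$ be the graph whose vertices are all $r$-element subsets of $\mathcal{R}_n$, two vertices $u,v$ being joined by an edge if and only if $|u\cap v|=s$. The chromatic number $\chi(G)$ of a graph $G$ is the least number of colors needed to color its vertices so that the endpoints of every edge have different colors.
   Formalization: Assumes 1 ≤ r ≤ n throughout (in (B) this excludes k = 1, where the graph is empty and the bound fails), and in (A) the lower bound n-r+2 for n-r odd is stated only for r ≥ 2, since for r = 1 and n even the graph is complete with chromatic number n < n+1. *)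

theory Defs
  imports Main "HOL-Computational_Algebra.Primes"
begin

text \<open>
  A finite simple graph is a pair of a vertex set and a set of edges, each edge being an
  unordered pair of distinct vertices, represented as a two-element set.
\<close>

type_synonym 'a graph = "'a set \<times> 'a set set"

definition verts :: "'a graph \<Rightarrow> 'a set" where
  "verts H = fst H"

definition edges :: "'a graph \<Rightarrow> 'a set set" where
  "edges H = snd H"

definition proper_coloring :: "'a graph \<Rightarrow> nat \<Rightarrow> ('a \<Rightarrow> nat) \<Rightarrow> bool" where
  "proper_coloring H k c \<longleftrightarrow>
     c ` verts H \<subseteq> {..<k} \<and> (\<forall>u v. {u, v} \<in> edges H \<longrightarrow> c u \<noteq> c v)"

definition chromatic_number :: "'a graph \<Rightarrow> nat" where
  "chromatic_number H = (LEAST k. \<exists>c. proper_coloring H k c)"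

definition subset_graph :: "nat \<Rightarrow> nat \<Rightarrow> nat \<Rightarrow> nat set graph" where
  "subset_graph n r s =
     (let V = {u. u \<subseteq> {0..<n} \<and> card u = r}
      in (V, {{u, v} | u v. u \<in> V \<and> v \<in> V \<and> u \<noteq> v \<and> card (u \<inter> v) = s}))"

text \<open>
  The \<open>LEAST\<close> in the chromatic number is attained for every graph considered here.
\<close>

lemma subset_graph_colorable: "\<exists>k c. proper_coloring (subset_graph n r s) k c"
proof -
  let ?V = "{u. u \<subseteq> {0..<n} \<and> card u = r}"
  have "finite ?V"
    by (rule finite_subset[of _ "Pow {0..<n}"]) auto
  then obtain c :: "nat set \<Rightarrow> nat" and k where c: "c ` ?V = {i. i < k}" "inj_on c ?V"
    using finite_imp_inj_to_nat_seg by blast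
  have "c u \<noteq> c v" if "{u, v} \<in> edges (subset_graph n r s)" for u v
    using that inj_onD[OF c(2)] unfolding edges_def subset_graph_def Let_def
    by (fastforce simp: doubleton_eq_iff)
  then have "proper_coloring (subset_graph n r s) k c"
    using c(1) by (auto simp: proper_coloring_def verts_def subset_graph_def)
  then show ?thesis by blast
qed

lemma proper_coloring_chromatic_number:
  "\<exists>c. proper_coloring (subset_graph n r s) (chromatic_number (subset_graph n r s)) c"
  unfolding chromatic_number_def by (rule LeastI_ex) (rule subset_graph_colorable)

end

theory Submission imports Defs begin

text \<open>
  Colouring a set by its sum modulo \<open>n\<close> is proper on \<open>G(n, r, r - 1)\<close>, because adjacent sets have the
  form \<open>I \<union> {x}\<close> and \<open>I \<union> {y}\<close> with distinct \<open>x, y < n\<close>; this gives the upper bound.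

  For the lower bounds, the \<open>r\<close>-sets that contain a given \<open>(r - 1)\<close>-set \<open>A\<close> form a clique of size
  \<open>n - r + 1\<close>, so at least that many colours occur.  If exactly \<open>n - r + 1\<close> colours suffice, every
  colour occurs exactly once in every such clique.  In other words, each colour class is a Steiner
  system: every \<open>(r - 1)\<close>-set lies in exactly one of its blocks.  The classical divisibility
  conditions for Steiner systems then apply: counting the pairs of a block \<open>B\<close> that contains a
  fixed \<open>t\<close>-set \<open>T\<close> and a point of \<open>B - T\<close> shows that \<open>r - t\<close> divides
  \<open>(n - t) choose (r - 1 - t)\<close> (\<open>optimal_coloring_divisibility\<close>).  Each improved bound contradicts
  one instance of this:
  \<^item> for \<open>t = r - 2\<close> the condition says that \<open>n - r + 2\<close> is even;
  \<^item> for \<open>t = 0\<close> it says that \<open>r\<close> divides \<open>n choose (r - 1)\<close>, which fails when \<open>r\<close> is prime and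
    \<open>n = r * k - 1\<close>, since none of the factors \<open>r * k - 1, \<dots>, r * k - (r - 1)\<close> of the
    numerator is a multiple of \<open>r\<close>.
\<close>

section \<open>The upper bound\<close>

lemma proper_coloring_subset_graph_iff:
  "proper_coloring (subset_graph n r s) k c \<longleftrightarrow>
     (\<forall>u. u \<subseteq> {0..<n} \<and> card u = r \<longrightarrow> c u < k) \<and>
     (\<forall>u v. u \<subseteq> {0..<n} \<and> card u = r \<and> v \<subseteq> {0..<n} \<and> card v = r \<and> u \<noteq> v \<and> card (u \<inter> v) = s
        \<longrightarrow> c u \<noteq> c v)"
proof -
  have "{u, v} \<in> edges (subset_graph n r s) \<longleftrightarrow>
      u \<subseteq> {0..<n} \<and> card u = r \<and> v \<subseteq> {0..<n} \<and> card v = r \<and> u \<noteq> v \<and> card (u \<inter> v) = s" for u v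
    unfolding edges_def subset_graph_def Let_def
    by (auto simp: doubleton_eq_iff Int_commute)
  then show ?thesis
    unfolding proper_coloring_def by (auto simp: verts_def subset_graph_def)
qed

lemma subset_graph_sum_coloring:
  assumes "1 \<le> r" and "r \<le> n"
  shows "proper_coloring (subset_graph n r (r - 1)) n (\<lambda>u. \<Sum>u mod n)"
  unfolding proper_coloring_subset_graph_iff
proof (intro conjI allI impI)
  show "\<Sum>u mod n < n" for u
    using assms by simp
next
  fix u v :: "nat set"
  assume uv: "u \<subseteq> {0..<n} \<and> card u = r \<and> v \<subseteq> {0..<n} \<and> card v = r \<and> u \<noteq> v \<and>
    card (u \<inter> v) = r - 1"
  then have fin: "finite u" "finite v"
    by (auto intro: finite_subset)
  have "card (u - v) = 1" "card (v - u) = 1"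
    using uv assms fin by (simp_all add: card_Diff_subset_Int Int_commute)
  then obtain x y where x: "u - v = {x}" and y: "v - u = {y}"
    by (meson card_1_singletonE)
  have xy: "x < n" "y < n" "x \<noteq> y"
    using x y uv by auto
  have "u = insert x (u \<inter> v)" "x \<notin> u \<inter> v" "v = insert y (u \<inter> v)" "y \<notin> u \<inter> v"
    using x y by auto
  then have sums: "\<Sum>u = x + \<Sum>(u \<inter> v)" "\<Sum>v = y + \<Sum>(u \<inter> v)"
    by (metis fin finite_Int sum.insert)+
  show "\<Sum>u mod n \<noteq> \<Sum>v mod n"
  proof
    assume "\<Sum>u mod n = \<Sum>v mod n"
    then have "(int x + int (\<Sum>(u \<inter> v))) mod int n = (int y + int (\<Sum>(u \<inter> v))) mod int n"
      unfolding sums by (metis of_nat_add of_nat_mod)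
    then have "int x mod int n = int y mod int n"
      by (metis add_diff_cancel_right' mod_diff_left_eq)
    then show False
      using xy by simp
  qed
qed

section \<open>Cliques of sets with a common (r - 1)-subset\<close>

lemma coloring_inj_on_star:
  assumes col: "proper_coloring (subset_graph n r (r - 1)) k c"
    and r: "1 \<le> r" and A: "A \<subseteq> {0..<n}" "card A = r - 1"
  shows "inj_on (\<lambda>x. c (insert x A)) ({0..<n} - A)"
    and "(\<lambda>x. c (insert x A)) ` ({0..<n} - A) \<subseteq> {..<k}"
    and "card ({0..<n} - A) = n - (r - 1)"
proof -
  have fin: "finite A"
    using A(1) finite_subset by blast
  have vert: "insert x A \<subseteq> {0..<n} \<and> card (insert x A) = r" if "x \<in> {0..<n} - A" for x
    using that A r fin by auto
  show "inj_on (\<lambda>x. c (insert x A)) ({0..<n} - A)"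
  proof (rule inj_onI, rule ccontr)
    fix x y
    assume x: "x \<in> {0..<n} - A" and y: "y \<in> {0..<n} - A" and ne: "x \<noteq> y"
      and eq: "c (insert x A) = c (insert y A)"
    have "insert x A \<inter> insert y A = A" "insert x A \<noteq> insert y A"
      using x y ne by auto
    then show False
      using col vert[OF x] vert[OF y] eq A(2)
      unfolding proper_coloring_subset_graph_iff by metis
  qed
  show "(\<lambda>x. c (insert x A)) ` ({0..<n} - A) \<subseteq> {..<k}"
    using col vert unfolding proper_coloring_subset_graph_iff by blast
  show "card ({0..<n} - A) = n - (r - 1)"
    using A fin by (simp add: card_Diff_subset)
qed

lemma clique_bound:
  assumes col: "proper_coloring (subset_graph n r (r - 1)) k c" and r: "1 \<le> r" "r \<le> n"
  shows "n - r + 1 \<le> k"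
proof -
  have A: "{0..<r - 1} \<subseteq> {0..<n}" "card {0..<r - 1} = r - 1"
    using r by auto
  have "card ({0..<n} - {0..<r - 1}) \<le> card {..<k}"
    using coloring_inj_on_star(1,2)[OF col r(1) A] by (rule card_inj_on_le) simp
  then show ?thesis
    using coloring_inj_on_star(3)[OF col r(1) A] r by simp
qed

text \<open>
  With only \<open>n - r + 1\<close> colours the colouring is a bijection on each of these cliques, so each
  colour class is a Steiner system.
\<close>

lemma optimal_coloring_unique_extension:
  assumes col: "proper_coloring (subset_graph n r (r - 1)) (n - r + 1) c"
    and r: "1 \<le> r" "r \<le> n" and A: "A \<subseteq> {0..<n}" "card A = r - 1" and i: "i < n - r + 1"
  shows "\<exists>!x. x \<in> {0..<n} - A \<and> c (insert x A) = i"
proof -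
  note star = coloring_inj_on_star[OF col r(1) A]
  have "card ((\<lambda>x. c (insert x A)) ` ({0..<n} - A)) = card {..<n - r + 1}"
    using star(3) r by (simp add: card_image[OF star(1)])
  then have "(\<lambda>x. c (insert x A)) ` ({0..<n} - A) = {..<n - r + 1}"
    using star(2) by (intro card_subset_eq) auto
  then have "i \<in> (\<lambda>x. c (insert x A)) ` ({0..<n} - A)"
    using i by simp
  then obtain x where x: "x \<in> {0..<n} - A" "c (insert x A) = i"
    by auto
  show ?thesis
  proof (rule ex1I[of _ x])
    show "y = x" if "y \<in> {0..<n} - A \<and> c (insert y A) = i" for y
      using inj_onD[OF star(1), of y x] that x by simp
  qed (use x in simp)
qed

section \<open>Divisibility conditions for Steiner systems\<close>

lemma card_subsets_containing:
  assumes "finite N" and "T \<subseteq> N" and "card T \<le> m"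
  shows "card {A. T \<subseteq> A \<and> A \<subseteq> N \<and> card A = m} = (card N - card T) choose (m - card T)"
proof -
  have finT: "finite T"
    using assms finite_subset by blast
  have "bij_betw (\<lambda>A. A - T) {A. T \<subseteq> A \<and> A \<subseteq> N \<and> card A = m}
      {D. D \<subseteq> N - T \<and> card D = m - card T}"
  proof (rule bij_betw_byWitness[where f' = "\<lambda>D. D \<union> T"])
    show "(\<lambda>A. A - T) ` {A. T \<subseteq> A \<and> A \<subseteq> N \<and> card A = m}
        \<subseteq> {D. D \<subseteq> N - T \<and> card D = m - card T}"
      using finT by (auto simp: card_Diff_subset)
    show "(\<lambda>D. D \<union> T) ` {D. D \<subseteq> N - T \<and> card D = m - card T}
        \<subseteq> {A. T \<subseteq> A \<and> A \<subseteq> N \<and> card A = m}"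
    proof clarify
      fix D assume D: "D \<subseteq> N - T" "card D = m - card T"
      have "card (D \<union> T) = card D + card T"
        using D(1) assms(1) finT by (intro card_Un_disjoint) (auto intro: finite_subset)
      then show "T \<subseteq> D \<union> T \<and> D \<union> T \<subseteq> N \<and> card (D \<union> T) = m"
        using D assms by auto
    qed
  qed auto
  then have "card {A. T \<subseteq> A \<and> A \<subseteq> N \<and> card A = m} = card {D. D \<subseteq> N - T \<and> card D = m - card T}"
    by (rule bij_betw_same_card)
  also have "\<dots> = (card N - card T) choose (m - card T)"
    using assms finT by (simp add: n_subsets card_Diff_subset)
  finally show ?thesis .
qed

text \<open>
  Removing the point \<open>x\<close> from the block \<open>B\<close> matches the pairs \<open>(B, x)\<close> with \<open>T \<subseteq> B\<close> and
  \<open>x \<in> B - T\<close> with the \<open>(r - 1)\<close>-sets that contain \<open>T\<close>, since each of those extends to exactly one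
  block of the colour class; and each block contributes \<open>r - card T\<close> pairs.
\<close>

lemma optimal_coloring_divisibility:
  assumes col: "proper_coloring (subset_graph n r (r - 1)) (n - r + 1) c"
    and r: "1 \<le> r" "r \<le> n" and T: "T \<subseteq> {0..<n}" "card T \<le> r - 1"
  shows "r - card T dvd (n - card T) choose (r - 1 - card T)"
proof -
  \<comment> \<open>Any colour class would do; colour 0 exists because there is at least one colour.\<close>
  define F where "F = {B. T \<subseteq> B \<and> B \<subseteq> {0..<n} \<and> card B = r \<and> c B = 0}"
  define E where "E = {A. T \<subseteq> A \<and> A \<subseteq> {0..<n} \<and> card A = r - 1}"
  have finT: "finite T"
    using T finite_subset by blast
  have finF: "finite F"
    by (rule finite_subset[of _ "Pow {0..<n}"]) (auto simp: F_def)
  have finB: "finite B" if "B \<in> F" for B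
    using that unfolding F_def by (auto intro: finite_subset)
  have ext: "\<exists>!x. x \<in> {0..<n} - A \<and> c (insert x A) = 0" if "A \<in> E" for A
    using optimal_coloring_unique_extension[OF col r, of A 0] that by (simp add: E_def)
  have uniq: "x = x'"
    if "A \<in> E" "x \<in> {0..<n} - A" "c (insert x A) = 0" "x' \<in> {0..<n} - A" "c (insert x' A) = 0"
    for A x x'
    using ext[OF that(1)] that(2-) by blast
  have del: "B - {x} \<in> E \<and> x \<in> {0..<n} - (B - {x}) \<and> insert x (B - {x}) = B \<and> c B = 0"
    if "B \<in> F" "x \<in> B - T" for B x
    using that finB[OF that(1)] by (auto simp: F_def E_def)
  have "bij_betw (\<lambda>(B, x). B - {x}) (SIGMA B:F. B - T) E"
  proof (rule bij_betw_imageI)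
    show "inj_on (\<lambda>(B, x). B - {x}) (SIGMA B:F. B - T)"
    proof (rule inj_onI, clarify)
      fix B x B' x'
      assume B: "B \<in> F" "x \<in> B" "x \<notin> T" and B': "B' \<in> F" "x' \<in> B'" "x' \<notin> T"
        and eq: "B - {x} = B' - {x'}"
      have "x \<in> {0..<n} - (B - {x}) \<and> c (insert x (B - {x})) = 0" "B - {x} \<in> E"
        using del[of B x] B by simp_all
      moreover have "x' \<in> {0..<n} - (B - {x}) \<and> c (insert x' (B - {x})) = 0"
        using del[of B' x'] B' unfolding eq by simp
      ultimately have "x = x'"
        using uniq[of "B - {x}" x x'] by simp
      then show "B = B' \<and> x = x'"
        using eq B(2) B'(2) by (metis insert_Diff)
    qed
    show "(\<lambda>(B, x). B - {x}) ` (SIGMA B:F. B - T) = E"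
    proof (intro equalityI subsetI)
      fix A assume "A \<in> (\<lambda>(B, x). B - {x}) ` (SIGMA B:F. B - T)"
      then show "A \<in> E"
        using del by auto
    next
      fix A assume A: "A \<in> E"
      then obtain x where x: "x \<in> {0..<n} - A" "c (insert x A) = 0"
        using ext by blast
      have "finite A"
        using A unfolding E_def by (auto intro: finite_subset)
      then have "(insert x A, x) \<in> (SIGMA B:F. B - T)"
        using A x r(1) by (auto simp: E_def F_def)
      moreover have "A = insert x A - {x}"
        using x by auto
      ultimately show "A \<in> (\<lambda>(B, x). B - {x}) ` (SIGMA B:F. B - T)"
        by (intro image_eqI[where x = "(insert x A, x)"]) simp_all
    qed
  qed
  then have "card E = card (SIGMA B:F. B - T)"
    by (simp add: bij_betw_same_card)
  also have "\<dots> = (\<Sum>B\<in>F. card (B - T))"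
    using finF finB by (intro card_SigmaI) auto
  also have "\<dots> = (\<Sum>B\<in>F. r - card T)"
    using finT by (intro sum.cong) (auto simp: F_def card_Diff_subset)
  finally have "card E = card F * (r - card T)"
    by simp
  moreover have "card E = (n - card T) choose (r - 1 - card T)"
    unfolding E_def using card_subsets_containing[of "{0..<n}" T "r - 1"] T by simp
  ultimately show ?thesis
    by (metis dvd_triv_right)
qed

text \<open>
  Passing from \<open>choose j\<close> to \<open>choose Suc j\<close> multiplies by \<open>p * k - Suc j\<close> and divides by \<open>Suc j\<close>;
  as long as \<open>Suc j < p\<close>, the new factor is congruent to \<open>- Suc j\<close> modulo \<open>p\<close> and so not divisible
  by \<open>p\<close>.
\<close>

lemma prime_not_dvd_choose:
  fixes p k j :: nat
  assumes p: "prime p" and "1 \<le> k" and "j < p"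
  shows "\<not> p dvd (p * k - 1) choose j"
  using \<open>j < p\<close>
proof (induction j)
  case 0
  then show ?case
    using p by (simp add: prime_nat_iff)
next
  case (Suc j)
  let ?n = "p * k - 1"
  have rec: "Suc j * (?n choose Suc j) = (?n - j) * (?n choose j)"
    using binomial_absorption[of j ?n] binomial_absorb_comp[of ?n j] by simp
  have le: "Suc j \<le> p * k"
    using Suc.prems \<open>1 \<le> k\<close> by (metis less_imp_le mult.right_neutral mult_le_mono2 order_trans)
  show ?case
  proof
    assume "p dvd ?n choose Suc j"
    then have "p dvd (?n - j) * (?n choose j)"
      by (metis dvd_mult rec)
    then have "p dvd ?n - j"
      using Suc p by (simp add: prime_dvd_mult_iff)
    moreover have "p * k = (?n - j) + Suc j"
      using le by simp
    ultimately have "p dvd Suc j"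
      by (metis dvd_add_right_iff dvd_triv_left)
    then show False
      using Suc.prems by (auto dest: dvd_imp_le)
  qed
qed

section \<open>The improved lower bounds\<close>

text \<open>
  One more colour than the clique bound is needed as soon as a single divisibility condition fails.
\<close>

lemma chromatic_number_improved_bound:
  assumes r: "1 \<le> r" "r \<le> n" and t: "t \<le> r - 1"
    and ndvd: "\<not> r - t dvd (n - t) choose (r - 1 - t)"
  shows "n - r + 2 \<le> chromatic_number (subset_graph n r (r - 1))"
proof -
  let ?\<chi> = "chromatic_number (subset_graph n r (r - 1))"
  obtain c where c: "proper_coloring (subset_graph n r (r - 1)) ?\<chi> c"
    using proper_coloring_chromatic_number by blast
  have "?\<chi> \<noteq> n - r + 1"
  proof
    assume "?\<chi> = n - r + 1"
    with c have "proper_coloring (subset_graph n r (r - 1)) (n - r + 1) c"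
      by simp
    moreover have "{0..<t} \<subseteq> {0..<n}"
      using r t by auto
    ultimately have "r - t dvd (n - t) choose (r - 1 - t)"
      using optimal_coloring_divisibility[of n r c "{0..<t}"] r t
      by (simp only: card_atLeastLessThan diff_zero)
    then show False
      using ndvd by blast
  qed
  then show ?thesis
    using clique_bound[OF c r] by simp
qed

theorem theorem2:
  shows "(\<forall>n r :: nat. 1 \<le> r \<and> r \<le> n \<longrightarrow>
            (even (n - r) \<longrightarrow>
               n \<ge> chromatic_number (subset_graph n r (r - 1)) \<and>
               chromatic_number (subset_graph n r (r - 1)) \<ge> n - r + 1) \<and>
            (odd (n - r) \<longrightarrow>
               n \<ge> chromatic_number (subset_graph n r (r - 1)) \<and>
               (r \<ge> 2 \<longrightarrow> chromatic_number (subset_graph n r (r - 1)) \<ge> n - r + 2)))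
       \<and> (\<forall>n r k :: nat. prime r \<and> n = r * k - 1 \<and> r \<le> n \<longrightarrow>
            chromatic_number (subset_graph n r (r - 1)) \<ge> n - r + 2)"
proof -
  have upper: "chromatic_number (subset_graph n r (r - 1)) \<le> n" if "1 \<le> r" "r \<le> n" for n r
    unfolding chromatic_number_def
    using subset_graph_sum_coloring[OF that] by (intro Least_le) blast
  have clique: "n - r + 1 \<le> chromatic_number (subset_graph n r (r - 1))"
    if "1 \<le> r" "r \<le> n" for n r
    using proper_coloring_chromatic_number clique_bound that by blast
  have odd_case: "n - r + 2 \<le> chromatic_number (subset_graph n r (r - 1))"
    if "2 \<le> r" "r \<le> n" "odd (n - r)" for n r
  proof (rule chromatic_number_improved_bound[where t = "r - 2"])
    have "(n - (r - 2)) choose (r - 1 - (r - 2)) = n - r + 2" "r - (r - 2) = 2"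
      using that by (simp_all add: numeral_2_eq_2)
    then show "\<not> r - (r - 2) dvd (n - (r - 2)) choose (r - 1 - (r - 2))"
      using that(3) by simp
  qed (use that in auto)
  have prime_case: "n - r + 2 \<le> chromatic_number (subset_graph n r (r - 1))"
    if "prime r" "n = r * k - 1" "r \<le> n" for n r k
  proof (rule chromatic_number_improved_bound[where t = 0])
    have "0 < r"
      using that(1) by (rule prime_gt_0_nat)
    moreover have "1 \<le> k"
      using that(2,3) \<open>0 < r\<close> by (cases k) auto
    ultimately show "\<not> r - 0 dvd (n - 0) choose (r - 1 - 0)"
      using prime_not_dvd_choose[OF that(1), of k "r - 1"] that(2) by simp
    show "1 \<le> r"
      using \<open>0 < r\<close> by simp
  qed (use that in auto)
  show ?thesis
    using upper clique odd_case prime_case by blast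
qed

end
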